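(* Let $N\ge 1$ be an integer and let $\mathcal{K}$ be a non-empty collection of simplices in $\mathbb{R}^N$. Then $\mathcal{K}$ is a simplicial complex if and only if the following two conditions hold: (1) every face of a simplex of $\mathcal{K}$ is in $\mathcal{K}$; (2) every pair of distinct simplices of $\mathcal{K}$ have disjoint interiors.
   Context: Points $\mathbf{a}_0,\ldots,\mathbf{a}_n$ of $\mathbb{R}^N$ are geometrically independent if for all real scalars $t_i$, the equations $\sum_i t_i=0$ and $\sum_i t_i\mathbf{a}_i=\mathbf{0}$ imply $t_i=0$ for all $i$. The simplex spanned by such points (its vertices) is $\sigma=\{\sum_{i=0}^n t_i\mathbf{a}_i : t_i\ge 0,\ \sum_i t_i=1\}$; its interior is $\operatorname{Int}(\sigma)=\{\sum_{i=0}^n t_i\mathbf{a}_i : t_i>0\ \forall i,\ \sum_i t_i=1\}$. A face of $\sigma$ is a simplex spanned by a non-empty subset of its vertices (including $\sigma$ itself; the others are the proper faces). A simplicial complex in $\mathbb{R}^N$ is a non-empty collection $\mathcal{K}$ of simplices in $\mathbb{R}^N$ such that every face of a simplex of $\mathcal{K}$ is in $\mathcal{K}$, and for all $\sigma,\tau\in\mathcal{K}$ the intersection $\sigma\cap\tau$ is either empty or a face of both $\sigma$ and $\tau$. Collections may be infinite. *)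

theory Defs
  imports "HOL-Analysis.Analysis"
begin

text \<open>
  Geometric independence of the points of a finite set \<open>V\<close> is affine independence,
  \<open>\<not> affine_dependent V\<close>, and the simplex spanned by \<open>V\<close> is \<open>convex hull V\<close>; the first two lemmas
  below give the coordinate descriptions. A geometrically independent family is injective, so
  sets of vertices lose nothing against families \<open>a\<^sub>0, \<dots>, a\<^sub>n\<close>. The library's \<open>n simplex \<sigma>\<close> allows
  \<open>n = -1\<close> (the empty simplex), its \<open>face_of\<close> allows the empty face, and its \<open>simplicial_complex\<close>
  is finite; none of these is wanted here.
\<close>

definition spans_simplex :: "'a::real_vector set \<Rightarrow> 'a set \<Rightarrow> bool" where
  "spans_simplex V \<sigma> \<longleftrightarrow> finite V \<and> V \<noteq> {} \<and> \<not> affine_dependent V \<and> \<sigma> = convex hull V"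

definition is_simplex :: "'a::real_vector set \<Rightarrow> bool" where
  "is_simplex \<sigma> \<longleftrightarrow> (\<exists>V. spans_simplex V \<sigma>)"

definition simplex_face :: "'a::real_vector set \<Rightarrow> 'a set \<Rightarrow> bool" where
  "simplex_face \<tau> \<sigma> \<longleftrightarrow> (\<exists>V W. spans_simplex V \<sigma> \<and> W \<subseteq> V \<and> spans_simplex W \<tau>)"

definition simplex_interior :: "'a::real_vector set \<Rightarrow> 'a set" where
  "simplex_interior \<sigma> =
    {\<Sum>v\<in>V. t v *\<^sub>R v | V t. spans_simplex V \<sigma> \<and> (\<forall>v\<in>V. t v > 0) \<and> sum t V = (1::real)}"

definition geom_simplicial_complex :: "'a::real_vector set set \<Rightarrow> bool" where
  "geom_simplicial_complex K \<longleftrightarrow>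
    K \<noteq> {} \<and>
    (\<forall>\<sigma>\<in>K. is_simplex \<sigma>) \<and>
    (\<forall>\<sigma>\<in>K. \<forall>\<tau>. simplex_face \<tau> \<sigma> \<longrightarrow> \<tau> \<in> K) \<and>
    (\<forall>\<sigma>\<in>K. \<forall>\<tau>\<in>K. \<sigma> \<inter> \<tau> = {} \<or> (simplex_face (\<sigma> \<inter> \<tau>) \<sigma> \<and> simplex_face (\<sigma> \<inter> \<tau>) \<tau>))"

lemma affine_independent_iff_geometrically_independent:
  fixes V :: "'a::real_vector set"
  assumes "finite V"
  shows "\<not> affine_dependent V \<longleftrightarrow>
    (\<forall>t. sum t V = (0::real) \<and> (\<Sum>v\<in>V. t v *\<^sub>R v) = 0 \<longrightarrow> (\<forall>v\<in>V. t v = 0))"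
  using assms by (auto simp: affine_dependent_explicit_finite)

lemma spans_simplex_explicit:
  fixes V :: "'a::real_vector set"
  assumes "spans_simplex V \<sigma>"
  shows "\<sigma> = {\<Sum>v\<in>V. t v *\<^sub>R v | t. (\<forall>v\<in>V. t v \<ge> 0) \<and> sum t V = (1::real)}"
  using assms by (auto simp: spans_simplex_def convex_hull_finite)

text \<open>The vertices are determined by the simplex, so the existential quantifiers over \<open>V\<close> in
  \<open>simplex_face\<close> and \<open>simplex_interior\<close> involve no choice.\<close>

lemma spans_simplex_unique:
  fixes \<sigma> :: "'a::euclidean_space set"
  assumes "spans_simplex V \<sigma>" "spans_simplex W \<sigma>"
  shows "V = W"
proof -
  have *: "U = {x. x extreme_point_of \<sigma>}" if "spans_simplex U \<sigma>" for U
    using that by (auto simp: spans_simplex_def extreme_point_of_convex_hull_affine_independent)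
  show ?thesis
    using *[OF assms(1)] *[OF assms(2)] by simp
qed

lemma simplex_interior_eq:
  fixes \<sigma> :: "'a::euclidean_space set"
  assumes "spans_simplex V \<sigma>"
  shows "simplex_interior \<sigma> = {\<Sum>v\<in>V. t v *\<^sub>R v | t. (\<forall>v\<in>V. t v > 0) \<and> sum t V = (1::real)}"
proof -
  have "spans_simplex W \<sigma> \<longleftrightarrow> W = V" for W
    using assms spans_simplex_unique by auto
  then show ?thesis
    by (simp add: simplex_interior_def)
qed

lemma simplex_face_iff:
  fixes \<sigma> :: "'a::euclidean_space set"
  assumes "spans_simplex V \<sigma>"
  shows "simplex_face \<tau> \<sigma> \<longleftrightarrow> (\<exists>W. W \<subseteq> V \<and> W \<noteq> {} \<and> \<tau> = convex hull W)"
proof -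
  have 1: "spans_simplex W \<sigma> \<longleftrightarrow> W = V" for W
    using assms spans_simplex_unique by auto
  have 2: "spans_simplex W \<tau> \<longleftrightarrow> W \<noteq> {} \<and> \<tau> = convex hull W" if "W \<subseteq> V" for W
    using that assms affine_independent_subset[of V W] finite_subset[of W V]
    by (simp add: spans_simplex_def)
  show ?thesis
    unfolding simplex_face_def 1 using 2 by simp blast
qed

end

theory Submission
  imports Defs
begin

text \<open>
  If a point lies in the interiors of \<open>\<sigma>\<close> and \<open>\<tau>\<close>, then \<open>\<sigma> \<inter> \<tau>\<close> is a face of both that meets
  their interiors, hence equals both. Conversely, every point of \<open>\<sigma> \<inter> \<tau>\<close> is interior to some face
  of \<open>\<sigma>\<close> and to some face of \<open>\<tau>\<close>; by disjointness of interiors these coincide, so their vertices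
  are common to \<open>\<sigma>\<close> and \<open>\<tau>\<close>, and \<open>\<sigma> \<inter> \<tau>\<close> is spanned by the common vertices.
\<close>

lemma spans_simplex_subset:
  assumes "spans_simplex V \<sigma>" "A \<subseteq> V" "A \<noteq> {}"
  shows "spans_simplex A (convex hull A)"
  using assms affine_independent_subset[of V A] finite_subset[of A V]
  by (simp add: spans_simplex_def)

text \<open>For affinely independent vertices the relative interior consists of the combinations
  with all coefficients positive. This identification makes the general theory of faces of convex
  sets available.\<close>

lemma simplex_interior_eq_rel_interior:
  fixes \<sigma> :: "'a::euclidean_space set"
  assumes "spans_simplex V \<sigma>"
  shows "simplex_interior \<sigma> = rel_interior \<sigma>"
proof -
  have "\<not> affine_dependent V" "\<sigma> = convex hull V"
    using assms by (auto simp: spans_simplex_def)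
  then show ?thesis
    using simplex_interior_eq[OF assms] rel_interior_convex_hull_explicit[of V] by auto
qed

text \<open>For affinely independent \<open>V\<close>, the convex-geometric faces of
  \<open>convex hull V\<close> are exactly the hulls of subsets of \<open>V\<close>.\<close>

lemma simplex_face_imp_face_of:
  fixes \<sigma> :: "'a::euclidean_space set"
  assumes "simplex_face \<tau> \<sigma>"
  shows "\<tau> face_of \<sigma>"
  using assms face_of_convex_hull_affine_independent
  unfolding simplex_face_def spans_simplex_def by blast

text \<open>A face of a convex set that contains a relative interior point contains the whole set:
  every point of the set is an endpoint of a segment having that interior point inside it.\<close>

lemma simplex_subset_face:
  fixes \<sigma> :: "'a::euclidean_space set"
  assumes "is_simplex \<sigma>" "simplex_face \<tau> \<sigma>" "\<tau> \<inter> simplex_interior \<sigma> \<noteq> {}"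
  shows "\<sigma> \<subseteq> \<tau>"
proof -
  obtain V where "spans_simplex V \<sigma>"
    using assms(1) by (auto simp: is_simplex_def)
  then have "simplex_interior \<sigma> = rel_interior \<sigma>"
    by (rule simplex_interior_eq_rel_interior)
  then show ?thesis
    using assms subset_of_face_of[OF simplex_face_imp_face_of[OF assms(2)] order_refl]
    by (auto simp: disjnt_def)
qed

lemma simplex_interior_subset:
  fixes \<sigma> :: "'a::euclidean_space set"
  shows "simplex_interior \<sigma> \<subseteq> \<sigma>"
proof
  fix x assume x: "x \<in> simplex_interior \<sigma>"
  then obtain V where "spans_simplex V \<sigma>"
    by (auto simp: simplex_interior_def)
  then show "x \<in> \<sigma>"
    using x simplex_interior_eq_rel_interior rel_interior_subset by blast
qed

lemma in_simplex_interior_of_face: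
  fixes \<sigma> :: "'a::euclidean_space set"
  assumes "spans_simplex V \<sigma>" "x \<in> \<sigma>"
  obtains A where "A \<subseteq> V" "A \<noteq> {}" "x \<in> simplex_interior (convex hull A)"
proof -
  have fin: "finite V"
    using assms(1) by (simp add: spans_simplex_def)
  obtain t where t: "\<forall>v\<in>V. t v \<ge> 0" "sum t V = (1::real)" "x = (\<Sum>v\<in>V. t v *\<^sub>R v)"
    using assms(2) unfolding spans_simplex_explicit[OF assms(1)] by blast
  \<comment> \<open>The vertices with positive barycentric coordinate at \<open>x\<close>; dropping
    the others changes neither sum.\<close>
  define A where "A = {v \<in> V. t v > 0}"
  have "A \<subseteq> V"
    by (auto simp: A_def)
  have zero: "t v = 0" if "v \<in> V - A" for v
    using that t(1) by (force simp: A_def)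
  have sum_A: "sum t A = 1"
    using sum.mono_neutral_left[OF fin \<open>A \<subseteq> V\<close>, of t] zero t(2) by simp
  have x_A: "x = (\<Sum>v\<in>A. t v *\<^sub>R v)"
    using sum.mono_neutral_left[OF fin \<open>A \<subseteq> V\<close>, of "\<lambda>v. t v *\<^sub>R v"] zero t(3) by simp
  have "A \<noteq> {}"
    using sum_A by auto
  moreover have "x \<in> simplex_interior (convex hull A)"
    unfolding simplex_interior_eq[OF spans_simplex_subset[OF assms(1) \<open>A \<subseteq> V\<close> \<open>A \<noteq> {}\<close>]]
    using sum_A x_A by (auto simp: A_def)
  ultimately show ?thesis
    using that \<open>A \<subseteq> V\<close> by blast
qed

text \<open>The hypothesis \<open>disjoint\<close> ranges over all faces because a common point may
  lie on the boundary of \<sigma> or \<tau>, and is then interior only to a proper face.\<close>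

lemma inter_simplices_eq_hull_common_vertices:
  fixes \<sigma> \<tau> :: "'a::euclidean_space set"
  assumes "spans_simplex V \<sigma>" "spans_simplex W \<tau>"
    and disjoint: "\<And>\<sigma>' \<tau>'. simplex_face \<sigma>' \<sigma> \<Longrightarrow> simplex_face \<tau>' \<tau> \<Longrightarrow> \<sigma>' \<noteq> \<tau>' \<Longrightarrow>
      simplex_interior \<sigma>' \<inter> simplex_interior \<tau>' = {}"
  shows "\<sigma> \<inter> \<tau> = convex hull (V \<inter> W)"
proof
  show "convex hull (V \<inter> W) \<subseteq> \<sigma> \<inter> \<tau>"
    using assms(1,2) hull_mono[of "V \<inter> W" V convex] hull_mono[of "V \<inter> W" W convex]
    by (auto simp: spans_simplex_def)
next
  show "\<sigma> \<inter> \<tau> \<subseteq> convex hull (V \<inter> W)"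
  proof
    fix x assume x: "x \<in> \<sigma> \<inter> \<tau>"
    obtain A where A: "A \<subseteq> V" "A \<noteq> {}" "x \<in> simplex_interior (convex hull A)"
      using in_simplex_interior_of_face[OF assms(1)] x by blast
    obtain B where B: "B \<subseteq> W" "B \<noteq> {}" "x \<in> simplex_interior (convex hull B)"
      using in_simplex_interior_of_face[OF assms(2)] x by blast
    have "simplex_face (convex hull A) \<sigma>" "simplex_face (convex hull B) \<tau>"
      unfolding simplex_face_iff[OF assms(1)] simplex_face_iff[OF assms(2)]
      using A(1,2) B(1,2) by blast+
    then have "convex hull A = convex hull B"
      using disjoint A(3) B(3) by blast
    \<comment> \<open>A simplex determines its vertices, as they are its extreme points.\<close>
    then have "A = B"
      using spans_simplex_unique[OF spans_simplex_subset[OF assms(1) A(1,2)]]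
        spans_simplex_subset[OF assms(2) B(1,2)] by simp
    then show "x \<in> convex hull (V \<inter> W)"
      using A B(1) simplex_interior_subset[of "convex hull A"]
        hull_mono[of A "V \<inter> W" convex] by blast
  qed
qed

theorem lemma4p3:
  fixes K :: "(real ^ 'n) set set"
  assumes "K \<noteq> {}"
    and "\<forall>\<sigma>\<in>K. is_simplex \<sigma>"
  shows "geom_simplicial_complex K \<longleftrightarrow>
    (\<forall>\<sigma>\<in>K. \<forall>\<tau>. simplex_face \<tau> \<sigma> \<longrightarrow> \<tau> \<in> K) \<and>
    (\<forall>\<sigma>\<in>K. \<forall>\<tau>\<in>K. \<sigma> \<noteq> \<tau> \<longrightarrow> simplex_interior \<sigma> \<inter> simplex_interior \<tau> = {})"
    (is "_ \<longleftrightarrow> ?faces \<and> ?disjoint")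
proof
  assume K: "geom_simplicial_complex K"
  have disjoint: ?disjoint
  proof (intro ballI impI, rule ccontr)
    fix \<sigma> \<tau> assume st: "\<sigma> \<in> K" "\<tau> \<in> K" "\<sigma> \<noteq> \<tau>"
      and "simplex_interior \<sigma> \<inter> simplex_interior \<tau> \<noteq> {}"
    then obtain x where x: "x \<in> simplex_interior \<sigma>" "x \<in> simplex_interior \<tau>"
      by blast
    then have "x \<in> \<sigma> \<inter> \<tau>"
      using simplex_interior_subset by blast
    moreover have "\<sigma> \<inter> \<tau> = {} \<or> (simplex_face (\<sigma> \<inter> \<tau>) \<sigma> \<and> simplex_face (\<sigma> \<inter> \<tau>) \<tau>)"
      using K st(1,2) unfolding geom_simplicial_complex_def by simp
    ultimately have "simplex_face (\<sigma> \<inter> \<tau>) \<sigma>" "simplex_face (\<sigma> \<inter> \<tau>) \<tau>"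
      by auto
    moreover have "\<sigma> \<inter> \<tau> \<inter> simplex_interior \<sigma> \<noteq> {}" "\<sigma> \<inter> \<tau> \<inter> simplex_interior \<tau> \<noteq> {}"
      using x \<open>x \<in> \<sigma> \<inter> \<tau>\<close> by blast+
    moreover have "is_simplex \<sigma>" "is_simplex \<tau>"
      using assms(2) st(1,2) by blast+
    ultimately have "\<sigma> \<subseteq> \<sigma> \<inter> \<tau>" "\<tau> \<subseteq> \<sigma> \<inter> \<tau>"
      by (auto dest: simplex_subset_face)
    \<comment> \<open>Both simplices equal their intersection, hence each other.\<close>
    then show False
      using st(3) by blast
  qed
  have faces: ?faces
    using K unfolding geom_simplicial_complex_def by (elim conjE)
  from faces disjoint show "?faces \<and> ?disjoint" ..
next
  assume *: "?faces \<and> ?disjoint"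
  from * have faces: ?faces ..
  from * have disjoint: ?disjoint ..
  have "simplex_face (\<sigma> \<inter> \<tau>) \<sigma> \<and> simplex_face (\<sigma> \<inter> \<tau>) \<tau>"
    if st: "\<sigma> \<in> K" "\<tau> \<in> K" "\<sigma> \<inter> \<tau> \<noteq> {}" for \<sigma> \<tau>
  proof -
    obtain V W where V: "spans_simplex V \<sigma>" and W: "spans_simplex W \<tau>"
      using assms(2) st(1,2) unfolding is_simplex_def by blast
    have eq: "\<sigma> \<inter> \<tau> = convex hull (V \<inter> W)"
    proof (rule inter_simplices_eq_hull_common_vertices[OF V W])
      \<comment> \<open>Closure under faces puts both faces in \<open>K\<close>, where disjointness
        of interiors applies.\<close>
      fix \<sigma>' \<tau>' assume "simplex_face \<sigma>' \<sigma>" "simplex_face \<tau>' \<tau>" "\<sigma>' \<noteq> \<tau>'"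
      moreover from this have "\<sigma>' \<in> K" "\<tau>' \<in> K"
        using faces st(1,2) by simp_all
      ultimately show "simplex_interior \<sigma>' \<inter> simplex_interior \<tau>' = {}"
        using disjoint by simp
    qed
    \<comment> \<open>The hull of the empty set is empty, so a common point forces a common vertex;
      a face must have one.\<close>
    then have "V \<inter> W \<noteq> {}"
      using st(3) by auto
    then show ?thesis
      unfolding simplex_face_iff[OF V] simplex_face_iff[OF W] eq by blast
  qed
  then show "geom_simplicial_complex K"
    using assms faces unfolding geom_simplicial_complex_def by (intro conjI) auto
qed

end
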